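(* Let $G = N \rtimes H$ be a semi-direct product of groups. If at least one of the components $N$, $H$ has a proper essential subgroup, then $G$ has a proper essential subgroup. If both $N$ and $H$ are abelian groups and the action of $H$ on $N$ is nontrivial, then $G$ contains a proper essential subgroup.
   Context: In $N \rtimes H$, the subgroup $N$ is normal and $H$ acts on $N$ through a homomorphism $H \to \mathrm{Aut}(N)$; the action is nontrivial if this homomorphism is nontrivial. A normal subgroup $E$ of a group $G$ is called an essential subgroup of $G$ if every nontrivial normal subgroup of $G$ intersects $E$ nontrivially; it is a proper essential subgroup if moreover $E \neq G$. *)

theory Defs
  imports "HOL-Algebra.Algebra"
begin

definition essential_subgroup :: "'a set \<Rightarrow> ('a, 'm) monoid_scheme \<Rightarrow> bool" where
  "essential_subgroup E G \<longleftrightarrow>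
     E \<lhd> G \<and> (\<forall>K. K \<lhd> G \<and> K \<noteq> {\<one>\<^bsub>G\<^esub>} \<longrightarrow> K \<inter> E \<noteq> {\<one>\<^bsub>G\<^esub>})"

definition proper_essential_subgroup :: "'a set \<Rightarrow> ('a, 'm) monoid_scheme \<Rightarrow> bool" where
  "proper_essential_subgroup E G \<longleftrightarrow> essential_subgroup E G \<and> E \<noteq> carrier G"

text \<open>The action is a homomorphism into the library's automorphism group \<^const>\<open>AutoGroup\<close>, whose
  elements are extensional functions on the carrier.\<close>

locale group_action_by_automorphisms =
  N: group N + H: group H
  for N :: "('a, 'm) monoid_scheme" and H :: "('b, 'n) monoid_scheme" +
  fixes \<phi> :: "'b \<Rightarrow> 'a \<Rightarrow> 'a"
  assumes action_hom: "\<phi> \<in> hom H (AutoGroup N)"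

definition nontrivial_action ::
  "('a, 'm) monoid_scheme \<Rightarrow> ('b, 'n) monoid_scheme \<Rightarrow> ('b \<Rightarrow> 'a \<Rightarrow> 'a) \<Rightarrow> bool" where
  "nontrivial_action N H \<phi> \<longleftrightarrow> (\<exists>h\<in>carrier H. \<phi> h \<noteq> \<one>\<^bsub>AutoGroup N\<^esub>)"

definition semidirect_product ::
  "('a, 'm) monoid_scheme \<Rightarrow> ('b, 'n) monoid_scheme \<Rightarrow> ('b \<Rightarrow> 'a \<Rightarrow> 'a) \<Rightarrow> ('a \<times> 'b) monoid" where
  "semidirect_product N H \<phi> =
     \<lparr>carrier = carrier N \<times> carrier H,
      monoid.mult = (\<lambda>(n, h) (n', h'). (n \<otimes>\<^bsub>N\<^esub> \<phi> h n', h \<otimes>\<^bsub>H\<^esub> h')),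
      monoid.one = (\<one>\<^bsub>N\<^esub>, \<one>\<^bsub>H\<^esub>)\<rparr>"

context group_action_by_automorphisms
begin

lemma action_auto: "h \<in> carrier H \<Longrightarrow> \<phi> h \<in> auto N"
  using action_hom by (auto simp: hom_def AutoGroup_def)

lemma action_closed: "h \<in> carrier H \<Longrightarrow> n \<in> carrier N \<Longrightarrow> \<phi> h n \<in> carrier N"
  using action_auto by (auto simp: auto_def hom_def)

lemma action_mult:
  "\<lbrakk>h \<in> carrier H; x \<in> carrier N; y \<in> carrier N\<rbrakk> \<Longrightarrow> \<phi> h (x \<otimes>\<^bsub>N\<^esub> y) = \<phi> h x \<otimes>\<^bsub>N\<^esub> \<phi> h y"
  using action_auto by (auto simp: auto_def hom_def)

lemma action_comp:
  assumes "h \<in> carrier H" "k \<in> carrier H" "n \<in> carrier N"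
  shows "\<phi> (h \<otimes>\<^bsub>H\<^esub> k) n = \<phi> h (\<phi> k n)"
proof -
  have "\<phi> (h \<otimes>\<^bsub>H\<^esub> k) = \<phi> h \<otimes>\<^bsub>AutoGroup N\<^esub> \<phi> k"
    using action_hom assms by (simp add: hom_mult)
  moreover have "\<phi> h \<in> Bij (carrier N)" "\<phi> k \<in> Bij (carrier N)"
    using action_auto assms by (auto simp: auto_def)
  ultimately show ?thesis
    using assms by (simp add: AutoGroup_def BijGroup_def compose_def)
qed

lemma action_one: "n \<in> carrier N \<Longrightarrow> \<phi> \<one>\<^bsub>H\<^esub> n = n"
proof -
  assume n: "n \<in> carrier N"
  have "\<phi> \<one>\<^bsub>H\<^esub> = \<one>\<^bsub>AutoGroup N\<^esub>"
    by (rule hom_one[OF action_hom H.is_group N.AutoGroup])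
  then show ?thesis using n by (simp add: AutoGroup_def BijGroup_def)
qed

lemma group_semidirect_product: "group (semidirect_product N H \<phi>)"
proof (rule groupI)
  fix x assume "x \<in> carrier (semidirect_product N H \<phi>)"
  then obtain n h where x: "x = (n, h)" "n \<in> carrier N" "h \<in> carrier H"
    by (auto simp: semidirect_product_def)
  let ?h = "inv\<^bsub>H\<^esub> h"
  let ?y = "(\<phi> ?h (inv\<^bsub>N\<^esub> n), ?h)"
  have "\<phi> ?h (inv\<^bsub>N\<^esub> n) \<otimes>\<^bsub>N\<^esub> \<phi> ?h n = \<phi> ?h \<one>\<^bsub>N\<^esub>"
    using x by (simp flip: action_mult)
  also have "\<dots> = \<one>\<^bsub>N\<^esub>"
    using action_auto[of ?h] x N.is_group by (auto simp: auto_def intro: hom_one)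
  finally show "\<exists>y\<in>carrier (semidirect_product N H \<phi>).
      y \<otimes>\<^bsub>semidirect_product N H \<phi>\<^esub> x = \<one>\<^bsub>semidirect_product N H \<phi>\<^esub>"
    using x by (intro bexI[of _ ?y]) (auto simp: semidirect_product_def action_closed)
qed (auto simp: semidirect_product_def action_closed action_mult action_comp action_one
       N.m_assoc H.m_assoc)

end

end

theory Submission
  imports Defs
begin

text \<open>If a group has no proper essential subgroup, then every normal subgroup \<open>K\<close> has a normal
  complement: for \<open>L\<close> maximal among the normal subgroups meeting \<open>K\<close> trivially, \<open>K L\<close> is essential.
  Thus \<open>N\<close> is a direct factor of such a semidirect product, with complement \<open>L\<close> centralising \<open>N\<close>.
  Hence normal subgroups of \<open>N\<close> are normal in the whole group, and a proper essential subgroup of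
  \<open>N\<close> would have a nontrivial complement within \<open>N\<close>.  If \<open>N\<close> is abelian, then \<open>N\<close>
  is central and the action is trivial.  Finally, a proper essential subgroup of \<open>H\<close> pulls back
  along the projection to \<open>H\<close>.\<close>

section \<open>Essential subgroups and preimages under surjections\<close>

lemma essential_subgroup_trivial:
  assumes "essential_subgroup E G" "K \<lhd> G" "K \<inter> E = {\<one>\<^bsub>G\<^esub>}"
  shows "K = {\<one>\<^bsub>G\<^esub>}"
  using assms unfolding essential_subgroup_def by blast

lemma (in group_hom) normal_preimage:
  assumes "K \<lhd> H"
  shows "{x \<in> carrier G. h x \<in> K} \<lhd> G"
proof (rule G.normal_invI)
  interpret K: normal K H by (rule assms)
  show "subgroup {x \<in> carrier G. h x \<in> K} G"
    by (rule G.subgroupI) auto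
  show "x \<otimes> y \<otimes> inv x \<in> {x \<in> carrier G. h x \<in> K}"
    if "x \<in> carrier G" "y \<in> {x \<in> carrier G. h x \<in> K}" for x y
    using that K.inv_op_closed2 by auto
qed

text \<open>If a normal \<open>K\<close> meets the preimage of \<open>E\<close> trivially, then
  \<open>h\<close>
  K\<open>meets\<close>E\<open>trivially, hence is trivial. So\<close>K\<open>lies in the kernel, which is part of the preimage, and\<close>K\<open>is trivial too. Surjectivity makes\<close>h
  \<open>K\<close> normal and keeps the preimage proper.\<close>

lemma (in group_hom) proper_essential_preimage:
  assumes surj: "h ` carrier G = carrier H" and E: "proper_essential_subgroup E H"
  shows "proper_essential_subgroup {x \<in> carrier G. h x \<in> E} G"
proof -
  let ?P = "{x \<in> carrier G. h x \<in> E}"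
  have ess: "essential_subgroup E H" and "E \<noteq> carrier H"
    using E by (auto simp: proper_essential_subgroup_def)
  then have nE: "E \<lhd> H" by (simp add: essential_subgroup_def)
  interpret E: normal E H by (rule nE)
  have "K = {\<one>}" if K: "K \<lhd> G" and triv: "K \<inter> ?P = {\<one>}" for K
  proof -
    interpret K: normal K G by (rule K)
    have "h ` K \<lhd> H"
      using K.surj_hom_normal_subgroup[OF group_hom_axioms surj] .
    moreover have "h ` K \<inter> E = {\<one>\<^bsub>H\<^esub>}"
    proof -
      have "h k = \<one>\<^bsub>H\<^esub>" if "k \<in> K" "h k \<in> E" for k
      proof -
        have "k \<in> K \<inter> ?P" using that K.subset by auto
        then show ?thesis using triv by simp
      qed
      moreover have "\<one>\<^bsub>H\<^esub> \<in> h ` K" using K.one_closed hom_one by (metis imageI)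
      ultimately show ?thesis using E.one_closed by blast
    qed
    ultimately have "h ` K = {\<one>\<^bsub>H\<^esub>}" by (rule essential_subgroup_trivial[OF ess])
    then have "h k \<in> E" if "k \<in> K" for k using imageI[OF that, of h] by simp
    then have "K \<subseteq> ?P" using K.subset by blast
    then show ?thesis using triv by auto
  qed
  moreover have "?P \<noteq> carrier G"
  proof
    assume "?P = carrier G"
    then have "h ` carrier G \<subseteq> E" by auto
    then have "carrier H \<subseteq> E" using surj by simp
    then show False using \<open>E \<noteq> carrier H\<close> E.subset by auto
  qed
  ultimately show ?thesis
    using normal_preimage[OF nE]
    unfolding proper_essential_subgroup_def essential_subgroup_def by blast
qed

section \<open>Normal complements by Zorn's lemma\<close>

text \<open>Provides the upper bounds for Zorn's lemma. Any two elements of the union already lie in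
  one member of the chain, which gives closure under products.\<close>

lemma (in group) normal_Union_chain:
  assumes "C \<noteq> {}" and norm: "\<And>L. L \<in> C \<Longrightarrow> L \<lhd> G"
    and chain: "\<And>L M. L \<in> C \<Longrightarrow> M \<in> C \<Longrightarrow> L \<subseteq> M \<or> M \<subseteq> L"
  shows "\<Union>C \<lhd> G"
proof (rule normal_invI)
  note sub = normal_imp_subgroup[OF norm]
  show "subgroup (\<Union>C) G"
  proof (rule subgroupI)
    show "\<Union>C \<subseteq> carrier G" using sub subgroup.subset by blast
    show "\<Union>C \<noteq> {}" using \<open>C \<noteq> {}\<close> sub subgroup.one_closed by blast
    show "inv a \<in> \<Union>C" if "a \<in> \<Union>C" for a
      using that sub subgroup.m_inv_closed by fastforce
    show "a \<otimes> b \<in> \<Union>C" if ab: "a \<in> \<Union>C" "b \<in> \<Union>C" for a b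
    proof -
      obtain L where "L \<in> C" "a \<in> L" "b \<in> L" using ab chain by blast
      then show ?thesis using subgroup.m_closed[OF sub] by blast
    qed
  qed
  show "x \<otimes> y \<otimes> inv x \<in> \<Union>C" if "x \<in> carrier G" "y \<in> \<Union>C" for x y
    using that norm normal.inv_op_closed2 by fastforce
qed

lemma (in group) exists_normal_complement:
  assumes no: "\<nexists>E. proper_essential_subgroup E G" and K: "K \<lhd> G"
  obtains L where "L \<lhd> G" "K \<inter> L = {\<one>}" "K <#> L = carrier G"
proof -
  interpret K: normal K G by (rule K)
  let ?A = "{L. L \<lhd> G \<and> K \<inter> L = {\<one>}}"
  have "\<exists>L\<in>?A. \<forall>M\<in>?A. L \<subseteq> M \<longrightarrow> M = L"
  proof (rule subset_Zorn_nonempty)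
    show "?A \<noteq> {}" using one_is_normal K.one_closed by auto
    show "\<Union>C \<in> ?A" if "C \<noteq> {}" and "subset.chain ?A C" for C
    proof -
      have C: "C \<subseteq> ?A" and "\<And>L M. L \<in> C \<Longrightarrow> M \<in> C \<Longrightarrow> L \<subseteq> M \<or> M \<subseteq> L"
        using that(2) by (auto simp: subset_chain_def)
      then have "\<Union>C \<lhd> G" using \<open>C \<noteq> {}\<close> by (intro normal_Union_chain) auto
      moreover have "K \<inter> \<Union>C = {\<one>}" using C \<open>C \<noteq> {}\<close> by blast
      ultimately show ?thesis by simp
    qed
  qed
  then obtain L where L: "L \<in> ?A" and max_L: "\<forall>M\<in>?A. L \<subseteq> M \<longrightarrow> M = L" ..
  from L have L: "L \<lhd> G" "K \<inter> L = {\<one>}" by simp_all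
  have max: "M = L" if "M \<lhd> G" "K \<inter> M = {\<one>}" "L \<subseteq> M" for M
    using that max_L by simp
  interpret L: normal L G by (rule L(1))
  have KL: "K <#> L \<lhd> G" by (rule normal_subgroup_set_mult_closed[OF K L(1)])
  interpret KL: normal "K <#> L" G by (rule KL)
  have "essential_subgroup (K <#> L) G"
    unfolding essential_subgroup_def
  proof (intro conjI KL allI impI notI)
    \<comment> \<open>If \<open>M\<close> meets \<open>K <#> L\<close> trivially, then
      \<open>L <#> M\<close> still meets \<open>K\<close> trivially. Maximality of \<open>L\<close>
      then puts \<open>M\<close> inside \<open>L\<close>, hence inside \<open>K <#> L\<close>, which
      forces \<open>M\<close> to be trivial.\<close>
    fix M assume M: "M \<lhd> G \<and> M \<noteq> {\<one>}" and triv: "M \<inter> (K <#> L) = {\<one>}"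
    interpret M: normal M G using M by blast
    have "L <#> M \<lhd> G" using M L by (intro normal_subgroup_set_mult_closed) auto
    moreover have "K \<inter> (L <#> M) = {\<one>}"
    proof -
      have "l \<otimes> m = \<one>" if lm: "l \<in> L" "m \<in> M" "l \<otimes> m \<in> K" for l m
      proof -
        \<comment> \<open>The factors \<open>\<one>\<close> exhibit \<open>l \<otimes> m\<close>
          from \<open>K\<close> and \<open>inv l\<close> from \<open>L\<close> as members of
          \<open>K <#> L\<close>. Multiplying them recovers \<open>m\<close>.\<close>
        have "l \<otimes> m \<otimes> \<one> \<in> K <#> L" "\<one> \<otimes> inv l \<in> K <#> L"
          using lm K.one_closed L.one_closed L.m_inv_closed unfolding set_mult_def by blast+
        then have "inv l \<otimes> (l \<otimes> m) \<in> K <#> L"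
          using lm KL.m_closed by auto
        then have "m \<in> M \<inter> (K <#> L)" using lm by (simp add: m_assoc[symmetric])
        then have "m = \<one>" using triv by simp
        then have "l \<in> K \<inter> L" using lm by simp
        then show ?thesis using L(2) \<open>m = \<one>\<close> by simp
      qed
      then have "K \<inter> (L <#> M) \<subseteq> {\<one>}" unfolding set_mult_def by blast
      moreover have "\<one> \<otimes> \<one> \<in> L <#> M"
        using L.one_closed M.one_closed unfolding set_mult_def by blast
      ultimately show ?thesis using K.one_closed by auto
    qed
    moreover have "L \<subseteq> L <#> M"
    proof
      fix l assume "l \<in> L"
      then have "l \<otimes> \<one> \<in> L <#> M" using M.one_closed unfolding set_mult_def by blast
      then show "l \<in> L <#> M" using \<open>l \<in> L\<close> by simp
    qed
    ultimately have LM: "L <#> M = L" by (rule max)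
    have "M \<subseteq> {\<one>}"
    proof
      fix m assume m: "m \<in> M"
      then have "\<one> \<otimes> m \<in> L <#> M" using L.one_closed unfolding set_mult_def by blast
      then have "m \<in> L" using LM m by simp
      then have "\<one> \<otimes> m \<in> K <#> L" using K.one_closed unfolding set_mult_def by blast
      then show "m \<in> {\<one>}" using triv m by auto
    qed
    then show False using M M.one_closed by auto
  qed
  then have "K <#> L = carrier G" using no by (auto simp: proper_essential_subgroup_def)
  then show thesis using that L by blast
qed

text \<open>The commutator of \<open>a\<close> and \<open>b\<close>, bracketed in two ways, is a
  product of elements of \<open>A\<close> and also one of elements of \<open>B\<close>, so it is
  trivial.\<close>

lemma (in group) normal_disjoint_commute:
  assumes "A \<lhd> G" "B \<lhd> G" "A \<inter> B = {\<one>}" "a \<in> A" "b \<in> B"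
  shows "a \<otimes> b = b \<otimes> a"
proof -
  interpret group_disjoint_sum G A B
    using assms by (auto simp: group_disjoint_sum_def normal_imp_subgroup)
  interpret A: normal A G by (rule assms)
  interpret B: normal B G by (rule assms)
  have ab: "a \<in> carrier G" "b \<in> carrier G" using assms by auto
  have "a \<otimes> (b \<otimes> inv a \<otimes> inv b) \<in> A"
    using assms A.inv_op_closed2[of b "inv a"] by auto
  moreover have "(a \<otimes> b \<otimes> inv a) \<otimes> inv b \<in> B"
    using assms B.inv_op_closed2[of a b] by auto
  ultimately have "a \<otimes> b \<otimes> inv a \<otimes> inv b \<in> A \<inter> B" using ab by (simp add: m_assoc)
  then have "a \<otimes> b \<otimes> inv (b \<otimes> a) = \<one>" using assms(3) ab by (simp add: m_assoc inv_mult_group)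
  then have "inv (inv (b \<otimes> a)) = a \<otimes> b" using ab by (intro inv_equality) auto
  then show ?thesis using ab by simp
qed

text \<open>Phrased for an injective homomorphism with normal image because \<open>N\<close> is not
  literally a subset of the semidirect product.\<close>

lemma (in group_hom) exists_proper_essential_of_normal_embedding:
  assumes inj: "inj_on h (carrier G)" and img: "h ` carrier G \<lhd> H"
    and E: "proper_essential_subgroup E G"
  shows "\<exists>F. proper_essential_subgroup F H"
proof (rule ccontr)
  assume no: "\<nexists>F. proper_essential_subgroup F H"
  have ess: "essential_subgroup E G" and "E \<noteq> carrier G"
    using E by (auto simp: proper_essential_subgroup_def)
  then have nE: "E \<lhd> G" by (simp add: essential_subgroup_def)
  interpret E: normal E G by (rule nE)
  obtain L where L: "L \<lhd> H" "h ` carrier G \<inter> L = {\<one>\<^bsub>H\<^esub>}" "h ` carrier G <#>\<^bsub>H\<^esub> L = carrier H"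
    using H.exists_normal_complement[OF no img] .
  interpret L: normal L H by (rule L(1))
  have "h ` E \<lhd> H"
  proof (rule H.normal_invI)
    show "subgroup (h ` E) H" by (rule subgroup_img_is_subgroup) (rule E.subgroup_axioms)
    \<comment> \<open>The factor of \<open>x\<close> in \<open>L\<close> centralises the image of
      \<open>h\<close>, so \<open>x\<close> conjugates \<open>h e\<close> just as \<open>h n\<close>
      does, and \<open>E\<close> is normal in \<open>G\<close>.\<close>
    fix x y assume x: "x \<in> carrier H" and y: "y \<in> h ` E"
    from x obtain n l where n: "n \<in> carrier G" "l \<in> L" "x = h n \<otimes>\<^bsub>H\<^esub> l"
      unfolding L(3)[symmetric] set_mult_def by auto
    from y obtain e where e: "e \<in> E" "y = h e" by blast
    have "l \<otimes>\<^bsub>H\<^esub> h e = h e \<otimes>\<^bsub>H\<^esub> l"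
      using H.normal_disjoint_commute[OF img L(1,2), of "h e" l] e n by simp
    then have "x \<otimes>\<^bsub>H\<^esub> y = h n \<otimes>\<^bsub>H\<^esub> h e \<otimes>\<^bsub>H\<^esub> l"
      using n e by (simp add: H.m_assoc)
    also have "\<dots> = h (n \<otimes> e \<otimes> inv n) \<otimes>\<^bsub>H\<^esub> x"
      using n e by (simp add: H.m_assoc) (simp add: H.m_assoc[symmetric])
    finally have "x \<otimes>\<^bsub>H\<^esub> y \<otimes>\<^bsub>H\<^esub> inv\<^bsub>H\<^esub> x = h (n \<otimes> e \<otimes> inv n)"
      using x n e by (simp add: H.m_assoc)
    moreover have "h (n \<otimes> e \<otimes> inv n) \<in> h ` E"
      using E.inv_op_closed2 n(1) e(1) by (intro imageI)
    ultimately show "x \<otimes>\<^bsub>H\<^esub> y \<otimes>\<^bsub>H\<^esub> inv\<^bsub>H\<^esub> x \<in> h ` E" by (simp only:)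
  qed
  then obtain M where M: "M \<lhd> H" "h ` E \<inter> M = {\<one>\<^bsub>H\<^esub>}" "h ` E <#>\<^bsub>H\<^esub> M = carrier H"
    using H.exists_normal_complement[OF no] by blast
  interpret M: normal M H by (rule M(1))
  let ?P = "{x \<in> carrier G. h x \<in> M}"
  have "?P \<inter> E = {\<one>}"
  proof -
    have "x = \<one>" if "x \<in> E" "h x \<in> M" for x
    proof -
      have "h x = h \<one>" using M(2) that by auto
      then show ?thesis using that by (intro inj_onD[OF inj]) auto
    qed
    then show ?thesis by auto
  qed
  then have P: "?P = {\<one>}" by (rule essential_subgroup_trivial[OF ess normal_preimage[OF M(1)]])
  have "carrier G \<subseteq> E"
  proof
    fix n assume n: "n \<in> carrier G"
    then have "h n \<in> h ` E <#>\<^bsub>H\<^esub> M" using M(3) by simp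
    then obtain e m where e: "e \<in> E" "m \<in> M" "h n = h e \<otimes>\<^bsub>H\<^esub> m"
      unfolding set_mult_def by auto
    \<comment> \<open>The component \<open>m\<close> is itself an image under \<open>h\<close>, so
      \<open>inv e \<otimes> n\<close> lies in the trivial group \<open>?P\<close> and
      \<open>n\<close> equals \<open>e\<close>.\<close>
    then have "h (inv e \<otimes> n) = m" using n by (simp add: H.m_assoc[symmetric])
    then have "inv e \<otimes> n \<in> ?P" using e n by simp
    then have "inv e \<otimes> n = \<one>" using P by simp
    then show "n \<in> E" using e n by (metis E.mem_carrier G.inv_closed G.inv_equality G.inv_inv)
  qed
  then show False using \<open>E \<noteq> carrier G\<close> E.subset by auto
qed

section \<open>Application to the semidirect product\<close>

context group_action_by_automorphisms
begin

abbreviation "NH \<equiv> semidirect_product N H \<phi>"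

lemma carrier_semidirect: "carrier NH = carrier N \<times> carrier H"
  by (simp add: semidirect_product_def)

lemma mult_semidirect: "(n, h) \<otimes>\<^bsub>NH\<^esub> (n', h') = (n \<otimes>\<^bsub>N\<^esub> \<phi> h n', h \<otimes>\<^bsub>H\<^esub> h')"
  by (simp add: semidirect_product_def)

lemma group_hom_snd: "group_hom NH H snd"
  using group_semidirect_product H.is_group
  by (auto simp: group_hom_def group_hom_axioms_def hom_def semidirect_product_def)

lemma group_hom_normal_factor: "group_hom N NH (\<lambda>n. (n, \<one>\<^bsub>H\<^esub>))"
  using group_semidirect_product N.is_group
  by (auto simp: group_hom_def group_hom_axioms_def hom_def semidirect_product_def action_one)

lemma snd_image_semidirect: "snd ` carrier NH = carrier H"
  using N.one_closed by (force simp: semidirect_product_def)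

lemma normal_factor_normal: "(\<lambda>n. (n, \<one>\<^bsub>H\<^esub>)) ` carrier N \<lhd> NH"
proof -
  have "(\<lambda>n. (n, \<one>\<^bsub>H\<^esub>)) ` carrier N = kernel NH H snd"
    by (auto simp: kernel_def semidirect_product_def)
  then show ?thesis using group_hom.normal_kernel[OF group_hom_snd] by simp
qed

text \<open>Conjugation by \<open>(\<one>, h)\<close> acts on the embedded copy of \<open>N\<close>
  as \<open>\<phi> h\<close>. That copy is central: it commutes with itself and with its normal
  complement \<open>L\<close>, and together they generate everything.\<close>

lemma action_trivial:
  assumes "comm_group N" and no: "\<nexists>E. proper_essential_subgroup E NH"
    and h: "h \<in> carrier H" and n: "n \<in> carrier N"
  shows "\<phi> h n = n"
proof -
  interpret G: group NH by (rule group_semidirect_product)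
  interpret comm_group N by (rule assms)
  let ?i = "\<lambda>n. (n, \<one>\<^bsub>H\<^esub>)"
  interpret i: group_hom N NH ?i by (rule group_hom_normal_factor)
  obtain L where L: "L \<lhd> NH" "?i ` carrier N \<inter> L = {\<one>\<^bsub>NH\<^esub>}" "?i ` carrier N <#>\<^bsub>NH\<^esub> L = carrier NH"
    using G.exists_normal_complement[OF no normal_factor_normal] .
  interpret L: normal L NH by (rule L(1))
  have "(\<one>\<^bsub>N\<^esub>, h) \<in> carrier NH" using h by (simp add: carrier_semidirect)
  then obtain a l where a: "a \<in> carrier N" "l \<in> L" "(\<one>\<^bsub>N\<^esub>, h) = ?i a \<otimes>\<^bsub>NH\<^esub> l"
    unfolding L(3)[symmetric] set_mult_def by blast
  have comm: "l \<otimes>\<^bsub>NH\<^esub> ?i n = ?i n \<otimes>\<^bsub>NH\<^esub> l"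
    using G.normal_disjoint_commute[OF normal_factor_normal L(1,2), of "?i n" l] a n by simp
  have c: "?i a \<in> carrier NH" "?i n \<in> carrier NH" "l \<in> carrier NH"
    using a n by simp_all
  have an: "?i a \<otimes>\<^bsub>NH\<^esub> ?i n = ?i n \<otimes>\<^bsub>NH\<^esub> ?i a"
    using a n m_comm by (simp flip: i.hom_mult)
  have "(\<one>\<^bsub>N\<^esub>, h) \<otimes>\<^bsub>NH\<^esub> ?i n = ?i a \<otimes>\<^bsub>NH\<^esub> (?i n \<otimes>\<^bsub>NH\<^esub> l)"
    unfolding a(3) using c comm by (simp only: G.m_assoc)
  also have "\<dots> = ?i n \<otimes>\<^bsub>NH\<^esub> (\<one>\<^bsub>N\<^esub>, h)"
    unfolding a(3) using c an by (simp only: G.m_assoc[symmetric])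
  \<comment> \<open>Both products are computed explicitly; their first coordinates are
    \<open>\<phi> h n\<close> and \<open>n\<close>.\<close>
  finally show ?thesis
    using h n by (simp add: mult_semidirect action_closed action_one)
qed

lemma exists_proper_essential_of_nontrivial_action:
  assumes "comm_group N" "nontrivial_action N H \<phi>"
  shows "\<exists>E. proper_essential_subgroup E NH"
proof (rule ccontr)
  assume no: "\<nexists>E. proper_essential_subgroup E NH"
  obtain h where h: "h \<in> carrier H" "\<phi> h \<noteq> \<one>\<^bsub>AutoGroup N\<^esub>"
    using assms(2) by (auto simp: nontrivial_action_def)
  \<comment> \<open>Fixing every element of \<open>N\<close> determines \<open>\<phi> h\<close> only
    on the carrier. Extensionality settles the values outside it, so that \<open>\<phi> h\<close>
    equals the restricted identity, the unit of \<open>AutoGroup N\<close>.\<close>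
  have "\<phi> h \<in> extensional (carrier N)"
    using action_auto[OF h(1)] by (auto simp: auto_def Bij_def)
  then have "\<phi> h = (\<lambda>x\<in>carrier N. x)"
    using action_trivial[OF assms(1) no h(1)] by (auto simp: extensional_def)
  then show False using h(2) by (simp add: AutoGroup_def BijGroup_def)
qed

end

theorem theorem2p13:
  fixes N :: "('a, 'm) monoid_scheme"
    and H :: "('b, 'n) monoid_scheme"
    and \<phi> :: "'b \<Rightarrow> 'a \<Rightarrow> 'a"
  assumes "group_action_by_automorphisms N H \<phi>"
  shows "((\<exists>E. proper_essential_subgroup E N) \<or> (\<exists>E. proper_essential_subgroup E H) \<longrightarrow>
            (\<exists>E. proper_essential_subgroup E (semidirect_product N H \<phi>))) \<and>
         (comm_group N \<and> comm_group H \<and> nontrivial_action N H \<phi> \<longrightarrow>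
            (\<exists>E. proper_essential_subgroup E (semidirect_product N H \<phi>)))"
proof -
  interpret group_action_by_automorphisms N H \<phi> by (rule assms)
  have "\<exists>E. proper_essential_subgroup E NH" if "proper_essential_subgroup E N" for E
    using group_hom.exists_proper_essential_of_normal_embedding
        [OF group_hom_normal_factor _ normal_factor_normal that]
    by (simp add: inj_on_def)
  moreover have "\<exists>E. proper_essential_subgroup E NH" if "proper_essential_subgroup E H" for E
    using group_hom.proper_essential_preimage[OF group_hom_snd snd_image_semidirect that] by blast
  ultimately show ?thesis using exists_proper_essential_of_nontrivial_action by blast
qed

end
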